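(* For all $a_1,a_2,a_3,b\in\mathbb{Z}_3$, $$\operatorname{rb}(\mathbb{Z}_3,\operatorname{eq}(a_1,a_2,a_3,b))=\begin{cases}3 & \text{if } b=0 \text{ and } a_i=a_j \text{ for some } i\neq j,\\ 3 & \text{if } b\neq 0 \text{ and } a_i\neq a_j \text{ for some } i\neq j,\\ 4 & \text{otherwise.}\end{cases}$$
   Context: $\mathbb{Z}_n$ denotes the integers modulo $n$ and $[r]=\{1,\dots,r\}$. An exact $r$-coloring of $\mathbb{Z}_n$ is a surjective function $c:\mathbb{Z}_n\to[r]$. $\operatorname{eq}(a_1,a_2,a_3,b)$ denotes the equation $a_1x_1+a_2x_2+a_3x_3=b$; a solution in $\mathbb{Z}_n$ is an ordered triple $(s_1,s_2,s_3)$ of elements of $\mathbb{Z}_n$ with $a_1s_1+a_2s_2+a_3s_3\equiv b \pmod n$. A solution is rainbow (with respect to $c$) if $|\{c(s_1),c(s_2),c(s_3)\}|=3$. The rainbow number $\operatorname{rb}(\mathbb{Z}_n,eq)$ is the smallest positive integer $r$ such that every exact $r$-coloring of $\mathbb{Z}_n$ has a rainbow solution to $eq$; by convention it equals $n+1$ if an exact $n$-coloring of $\mathbb{Z}_n$ contains no rainbow solution. *)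

theory Defs
  imports "HOL-Number_Theory.Number_Theory"
begin

text \<open>
  Elements of \<open>\<int>\<^sub>n\<close> are represented by the least nonnegative residues, that is, by the carrier
  \<open>{0..int n - 1}\<close> of \<^const>\<open>residue_ring\<close>.  A coloring is a function on the
  integers of which only the values on this carrier matter.
\<close>

abbreviation Zmod :: "nat \<Rightarrow> int set" where
  "Zmod n \<equiv> carrier (residue_ring (int n))"

definition exact_coloring :: "nat \<Rightarrow> nat \<Rightarrow> (int \<Rightarrow> nat) \<Rightarrow> bool" where
  "exact_coloring n r c \<longleftrightarrow> c ` Zmod n = {1..r}"

definition solutions :: "nat \<Rightarrow> int \<Rightarrow> int \<Rightarrow> int \<Rightarrow> int \<Rightarrow> (int \<times> int \<times> int) set" where
  "solutions n a1 a2 a3 b =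
     {(s1, s2, s3). s1 \<in> Zmod n \<and> s2 \<in> Zmod n \<and> s3 \<in> Zmod n \<and>
        [a1 * s1 + a2 * s2 + a3 * s3 = b] (mod int n)}"

definition rainbow :: "(int \<Rightarrow> nat) \<Rightarrow> int \<times> int \<times> int \<Rightarrow> bool" where
  "rainbow c = (\<lambda>(s1, s2, s3). card {c s1, c s2, c s3} = 3)"

definition has_rainbow_solution ::
    "nat \<Rightarrow> int \<Rightarrow> int \<Rightarrow> int \<Rightarrow> int \<Rightarrow> (int \<Rightarrow> nat) \<Rightarrow> bool" where
  "has_rainbow_solution n a1 a2 a3 b c \<longleftrightarrow> (\<exists>s\<in>solutions n a1 a2 a3 b. rainbow c s)"

text \<open>
  The first branch is the usual convention for the case where even an exact \<open>n\<close>-coloring can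
  avoid rainbow solutions.  In the second branch \<open>r = n\<close> has the required property if
  \<open>n > 0\<close>, so the minimum is attained.
\<close>

definition rb :: "nat \<Rightarrow> int \<Rightarrow> int \<Rightarrow> int \<Rightarrow> int \<Rightarrow> nat" where
  "rb n a1 a2 a3 b =
     (if \<exists>c. exact_coloring n n c \<and> \<not> has_rainbow_solution n a1 a2 a3 b c
      then n + 1
      else (LEAST r. r > 0 \<and>
              (\<forall>c. exact_coloring n r c \<longrightarrow> has_rainbow_solution n a1 a2 a3 b c)))"

end

theory Submission
  imports Defs
begin

text \<open>
  An exact 3-coloring of \<open>\<int>\<^sub>3\<close> is a bijection, so for it a solution is rainbow precisely when its
  three entries are distinct; in particular the answer does not depend on which exact 3-coloring
  is chosen. Colorings with fewer than three colors have no rainbow triples at all. Hence the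
  rainbow number is \<open>3\<close> if some permutation of \<open>0, 1, 2\<close> solves the equation and \<open>4\<close> otherwise
  (lemma \<open>rb_3_eq\<close>).

  It remains to see which values \<open>a1 * s1 + a2 * s2 + a3 * s3\<close> takes modulo 3 on the permutations
  of \<open>0, 1, 2\<close>. Since \<open>s1 + s2 + s3\<close> vanishes modulo 3, adding the same constant to all
  coefficients changes nothing. If the coefficients are all equal, only the value \<open>0\<close> occurs. If
  exactly two of them are equal, they may be taken to be \<open>0\<close>, so the value is a nonzero multiple
  of a single unknown and every residue occurs. If all three are distinct, they may be taken to
  be \<open>0, 1, 2\<close>, so the value is the difference of two distinct unknowns, and exactly the nonzero
  residues occur. Lemma \<open>distinct_solution_mod_3_iff\<close> records the outcome; as there are only
  finitely many coefficients and permutations, it is verified by enumeration.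
\<close>

lemma Zmod_eq: "n > 0 \<Longrightarrow> Zmod n = {0..int n - 1}"
  by (simp add: residue_ring_def)

lemma Zmod_3: "Zmod 3 = {0, 1, 2}"
  by (auto simp: residue_ring_def)

lemma exact_coloring_inj_on:
  assumes "n > 0" and "exact_coloring n n c"
  shows "inj_on c (Zmod n)"
proof (rule eq_card_imp_inj_on)
  show "finite (Zmod n)"
    using assms(1) by (simp add: Zmod_eq)
  show "card (c ` Zmod n) = card (Zmod n)"
    using assms by (simp add: Zmod_eq exact_coloring_def)
qed

lemma rainbow_iff: "rainbow c (s1, s2, s3) \<longleftrightarrow> distinct [c s1, c s2, c s3]"
  by (auto simp: rainbow_def card_insert_if)

lemma has_rainbow_solution_iff_distinct:
  assumes "n > 0" and "exact_coloring n n c"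
  shows "has_rainbow_solution n a1 a2 a3 b c \<longleftrightarrow>
    (\<exists>s1 s2 s3. (s1, s2, s3) \<in> solutions n a1 a2 a3 b \<and> distinct [s1, s2, s3])"
proof -
  have "rainbow c (s1, s2, s3) \<longleftrightarrow> distinct [s1, s2, s3]"
    if "(s1, s2, s3) \<in> solutions n a1 a2 a3 b" for s1 s2 s3
    using that exact_coloring_inj_on[OF assms]
    by (auto simp: rainbow_iff solutions_def inj_on_eq_iff)
  then show ?thesis
    unfolding has_rainbow_solution_def by (metis prod_cases3)
qed

lemma few_colors_no_rainbow_solution:
  assumes "exact_coloring n r c" and "r < 3"
  shows "\<not> has_rainbow_solution n a1 a2 a3 b c"
proof
  assume "has_rainbow_solution n a1 a2 a3 b c"
  then obtain s1 s2 s3 where s: "s1 \<in> Zmod n" "s2 \<in> Zmod n" "s3 \<in> Zmod n"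
    and card: "card {c s1, c s2, c s3} = 3"
    by (auto simp: has_rainbow_solution_def solutions_def rainbow_def)
  have "{c s1, c s2, c s3} \<subseteq> {1..r}"
    using s assms(1) by (auto simp: exact_coloring_def)
  then have "card {c s1, c s2, c s3} \<le> card {1..r}"
    by (rule card_mono[OF finite_atLeastAtMost])
  with card assms(2) show False
    by simp
qed

text \<open>
  The minimum in \<^const>\<open>rb\<close> ranges over all \<open>r > 0\<close> such that every exact \<open>r\<close>-coloring has a
  rainbow solution. To exclude \<open>r = 1\<close> and \<open>r = 2\<close> there, it has to be known that this condition
  is not vacuous.
\<close>

lemma exact_coloring_exists:
  assumes "0 < r" and "r \<le> n"
  shows "\<exists>c. exact_coloring n r c"
proof
  let ?c = "\<lambda>x. min (nat x + 1) r"
  have "k \<in> ?c ` {0..int n - 1}" if "k \<in> {1..r}" for k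
    using that assms by (intro image_eqI[where x = "int k - 1"]) auto
  then have "?c ` {0..int n - 1} = {1..r}"
    using assms by auto
  then show "exact_coloring n r ?c"
    using assms by (simp add: exact_coloring_def Zmod_eq)
qed

lemma rb_3_eq:
  "rb 3 a1 a2 a3 b =
    (if \<exists>s1 s2 s3. (s1, s2, s3) \<in> solutions 3 a1 a2 a3 b \<and> distinct [s1, s2, s3]
     then 3 else 4)"
proof (cases "\<exists>s1 s2 s3. (s1, s2, s3) \<in> solutions 3 a1 a2 a3 b \<and> distinct [s1, s2, s3]")
  case True
  then have all: "has_rainbow_solution 3 a1 a2 a3 b c" if "exact_coloring 3 3 c" for c
    using has_rainbow_solution_iff_distinct[OF _ that] by simp
  have "(LEAST r. r > 0 \<and> (\<forall>c. exact_coloring 3 r c \<longrightarrow> has_rainbow_solution 3 a1 a2 a3 b c)) = 3"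
  proof (rule Least_equality)
    show "(0::nat) < 3 \<and> (\<forall>c. exact_coloring 3 3 c \<longrightarrow> has_rainbow_solution 3 a1 a2 a3 b c)"
      using all by simp
  next
    fix r :: nat
    assume r: "r > 0 \<and> (\<forall>c. exact_coloring 3 r c \<longrightarrow> has_rainbow_solution 3 a1 a2 a3 b c)"
    show "3 \<le> r"
    proof (rule ccontr)
      assume "\<not> 3 \<le> r"
      then obtain c where "exact_coloring 3 r c"
        using r exact_coloring_exists[of r 3] by auto
      then show False
        using r few_colors_no_rainbow_solution \<open>\<not> 3 \<le> r\<close> not_le by blast
    qed
  qed
  with True all show ?thesis
    by (auto simp: rb_def)
next
  case False
  obtain c where c: "exact_coloring 3 3 c"
    using exact_coloring_exists[of 3 3] by auto
  then have "\<not> has_rainbow_solution 3 a1 a2 a3 b c"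
    using False has_rainbow_solution_iff_distinct[of 3 c a1 a2 a3 b] by simp
  with c have "\<exists>c. exact_coloring 3 3 c \<and> \<not> has_rainbow_solution 3 a1 a2 a3 b c"
    by blast
  with False show ?thesis
    by (simp add: rb_def)
qed

text \<open>
  The role of \<open>b = 0\<close> comes from \<open>0 + 1 + 2\<close> being \<open>0\<close> modulo 3: constant coefficients reach
  only \<open>b = 0\<close>, and distinct ones reach only \<open>b \<noteq> 0\<close>.
\<close>

lemma distinct_solution_mod_3_iff:
  assumes "a1 \<in> Zmod 3" and "a2 \<in> Zmod 3" and "a3 \<in> Zmod 3" and "b \<in> Zmod 3"
  shows "(\<exists>s1 s2 s3. (s1, s2, s3) \<in> solutions 3 a1 a2 a3 b \<and> distinct [s1, s2, s3]) \<longleftrightarrow>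
    (if b = 0 then a1 = a2 \<or> a1 = a3 \<or> a2 = a3 else a1 \<noteq> a2 \<or> a1 \<noteq> a3 \<or> a2 \<noteq> a3)"
    (is "?L \<longleftrightarrow> ?R")
proof -
  have "?L \<longleftrightarrow> (\<exists>s1\<in>Zmod 3. \<exists>s2\<in>Zmod 3. \<exists>s3\<in>Zmod 3.
      distinct [s1, s2, s3] \<and> [a1 * s1 + a2 * s2 + a3 * s3 = b] (mod 3))"
    unfolding solutions_def mem_Collect_eq prod.case of_nat_numeral Bex_def by meson
  \<comment> \<open>Evaluating the quantifiers leaves one congruence for each permutation of \<open>0, 1, 2\<close>.\<close>
  also have "\<dots> \<longleftrightarrow>
      [a2 + a3 * 2 = b] (mod 3) \<or> [a2 * 2 + a3 = b] (mod 3) \<or>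
      [a1 + a3 * 2 = b] (mod 3) \<or> [a1 * 2 + a3 = b] (mod 3) \<or>
      [a1 + a2 * 2 = b] (mod 3) \<or> [a1 * 2 + a2 = b] (mod 3)"
    unfolding Zmod_3 by (simp add: disj_ac)
  \<comment> \<open>The \<open>3 ^ 4\<close> choices of coefficients and right-hand side are checked one by one.\<close>
  also have "\<dots> \<longleftrightarrow> ?R"
    using assms unfolding Zmod_3 by (elim insertE emptyE) (simp_all add: cong_def)
  finally show ?thesis .
qed

theorem proposition2p2:
  fixes a1 a2 a3 b :: int
  assumes "a1 \<in> Zmod 3" and "a2 \<in> Zmod 3" and "a3 \<in> Zmod 3" and "b \<in> Zmod 3"
  shows "rb 3 a1 a2 a3 b =
    (if b = 0 \<and> (a1 = a2 \<or> a1 = a3 \<or> a2 = a3) then 3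
     else if b \<noteq> 0 \<and> (a1 \<noteq> a2 \<or> a1 \<noteq> a3 \<or> a2 \<noteq> a3) then 3
     else 4)"
  unfolding rb_3_eq distinct_solution_mod_3_iff[OF assms] by simp

end
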